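(* Let $\lambda_0,\lambda_1>0$ and let $\bm{M}_0^\star$ be the optimal solution of $\min_{\bm{M}\succeq\bm{O}}P_{\lambda_0}(\bm{M})$. Suppose that $\bm{M}_0^\star$ is used as the reference solution $\bm{M}$ of the Projected Gradient Bound (PGB) for $\lambda_1$. Then there exists a subgradient $\nabla P_{\lambda_1}(\bm{M}_0^\star)$ of $P_{\lambda_1}$ at $\bm{M}_0^\star$ for which PGB (for $\lambda_1$) and the Regularization Path Bound (RPB) have the same center and the same radius; that is, $$\left[\bm{M}_0^\star-\frac{1}{2\lambda_1}\nabla P_{\lambda_1}(\bm{M}_0^\star)\right]_+=\frac{\lambda_0+\lambda_1}{2\lambda_1}\bm{M}_0^\star$$ and $$\left(\frac{1}{2\lambda_1}\|\nabla P_{\lambda_1}(\bm{M}_0^\star)\|_F\right)^2-\left\|\left[\bm{M}_0^\star-\frac{1}{2\lambda_1}\nabla P_{\lambda_1}(\bm{M}_0^\star)\right]_-\right\|_F^2=\left(\frac{\lambda_0-\lambda_1}{2\lambda_1}\|\bm{M}_0^\star\|_F\right)^2.$$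
   Context: Let $\bm{x}_1,\dots,\bm{x}_n\in\mathbb{R}^d$ have labels $y_1,\dots,y_n$ in a discrete set, and let $\mathcal{T}=\{(i,j,l)\in\{1,\dots,n\}^3\mid y_i=y_j,\ i\neq j,\ y_i\neq y_l\}$. For $(i,j,l)\in\mathcal{T}$ put $\bm{H}_{ijl}=(\bm{x}_i-\bm{x}_l)(\bm{x}_i-\bm{x}_l)^\top-(\bm{x}_i-\bm{x}_j)(\bm{x}_i-\bm{x}_j)^\top$. $\langle \bm{A},\bm{B}\rangle=\mathrm{tr}(\bm{A}^\top\bm{B})$, $\|\bm{A}\|_F^2=\langle\bm{A},\bm{A}\rangle$, and $\bm{M}\succeq\bm{O}$ means that $\bm{M}\in\mathbb{R}^{d\times d}$ is (symmetric) positive semi-definite. For a symmetric matrix $\bm{A}$ with eigenvalue decomposition $\bm{A}=\bm{V}\bm{\Lambda}\bm{V}^\top$, $[\bm{A}]_+=\bm{V}\bm{\Lambda}_+\bm{V}^\top$ and $[\bm{A}]_-=\bm{V}\bm{\Lambda}_-\bm{V}^\top$, where $\bm{\Lambda}_+$ and $\bm{\Lambda}_-$ keep only the positive, respectively negative, diagonal entries of $\bm{\Lambda}$. The loss $\ell:\mathbb{R}\to\mathbb{R}$ is either the hinge loss $\ell(x)=\max\{0,1-x\}$ (parameter $\gamma=0$), or, for a parameter $\gamma>0$, the smoothed hinge loss: $\ell(x)=0$ for $x>1$, $\ell(x)=\frac{1}{2\gamma}(1-x)^2$ for $1-\gamma\le x\le1$, $\ell(x)=1-x-\frac{\gamma}{2}$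 for $x<1-\gamma$. For $\lambda>0$ the primal objective is $P_\lambda(\bm{M})=\sum_{(i,j,l)\in\mathcal{T}}\ell(\langle\bm{M},\bm{H}_{ijl}\rangle)+\frac{\lambda}{2}\|\bm{M}\|_F^2$. A subgradient $\nabla P_\lambda(\bm{M})$ is a matrix of the form $\sum_{(i,j,l)\in\mathcal{T}}g_{ijl}\bm{H}_{ijl}+\lambda\bm{M}$ with $g_{ijl}\in\partial\ell(\langle\bm{M},\bm{H}_{ijl}\rangle)$. PGB for $\lambda$: given a reference solution $\bm{M}\succeq\bm{O}$ and a subgradient $\nabla P_\lambda(\bm{M})$, with $\bm{Q}=\bm{M}-\frac{1}{2\lambda}\nabla P_\lambda(\bm{M})$, the ball with center $[\bm{Q}]_+$ and squared radius $\left(\frac{1}{2\lambda}\|\nabla P_\lambda(\bm{M})\|_F\right)^2-\|[\bm{Q}]_-\|_F^2$. RPB for $\lambda_1$ based on $\lambda_0$: the ball with center $\frac{\lambda_0+\lambda_1}{2\lambda_1}\bm{M}_0^\star$ and squared radius $\left(\frac{\lambda_0-\lambda_1}{2\lambda_1}\|\bm{M}_0^\star\|_F\right)^2$. *)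

theory Defs
  imports "HOL-Analysis.Analysis"
begin

section \<open>Matrices\<close>

definition frob_inner :: "real^'d^'d \<Rightarrow> real^'d^'d \<Rightarrow> real" where
  "frob_inner A B = trace (transpose A ** B)"

definition frob_norm :: "real^'d^'d \<Rightarrow> real" where
  "frob_norm A = sqrt (frob_inner A A)"

lemma frob_inner_eq_inner: "frob_inner A B = A \<bullet> B"
proof -
  have "frob_inner A B = (\<Sum>j\<in>UNIV. \<Sum>i\<in>UNIV. A $ i $ j * B $ i $ j)"
    by (simp add: frob_inner_def trace_def matrix_matrix_mult_def transpose_def)
  also have "\<dots> = (\<Sum>i\<in>UNIV. \<Sum>j\<in>UNIV. A $ i $ j * B $ i $ j)"
    by (rule sum.swap)
  finally show ?thesis by (simp add: inner_vec_def)
qed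

lemma frob_norm_eq_norm: "frob_norm A = norm A"
  by (simp add: frob_norm_def frob_inner_eq_inner norm_eq_sqrt_inner)

definition outer_prod :: "real^'d \<Rightarrow> real^'d \<Rightarrow> real^'d^'d" where
  "outer_prod u v = (\<chi> a b. u $ a * v $ b)"

definition psd :: "real^'d^'d \<Rightarrow> bool" where
  "psd M \<longleftrightarrow> transpose M = M \<and> (\<forall>v. 0 \<le> v \<bullet> (M *v v))"

definition diag_mat :: "real^'d \<Rightarrow> real^'d^'d" where
  "diag_mat v = (\<chi> i j. if i = j then v $ i else 0)"

text \<open>\<open>A = V \<Lambda> V\<^sup>T\<close> with \<open>V\<close> orthogonal and \<open>\<Lambda> = diag_mat ev\<close>.\<close>

definition eigen_decomp :: "real^'d^'d \<Rightarrow> real^'d^'d \<Rightarrow> real^'d \<Rightarrow> bool" where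
  "eigen_decomp A V ev \<longleftrightarrow>
     orthogonal_matrix V \<and> A = V ** diag_mat ev ** transpose V"

text \<open>The value does not depend on the chosen decomposition, as \<open>pos_part_eqI\<close> and
  \<open>neg_part_eqI\<close> below show. For non-symmetric \<open>A\<close> it is unspecified.\<close>

definition pos_part :: "real^'d^'d \<Rightarrow> real^'d^'d" where
  "pos_part A = (THE B. \<exists>V ev. eigen_decomp A V ev \<and>
     B = V ** diag_mat (\<chi> i. if ev $ i > 0 then ev $ i else 0) ** transpose V)"

definition neg_part :: "real^'d^'d \<Rightarrow> real^'d^'d" where
  "neg_part A = (THE B. \<exists>V ev. eigen_decomp A V ev \<and>
     B = V ** diag_mat (\<chi> i. if ev $ i < 0 then ev $ i else 0) ** transpose V)"

lemma diag_mat_mult_left: "(diag_mat v ** A) $ i $ j = v $ i * A $ i $ j"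
  by (simp add: diag_mat_def matrix_matrix_mult_def if_distrib [of "\<lambda>x. x * _"] cong: if_cong)

lemma diag_mat_mult_right: "(A ** diag_mat v) $ i $ j = A $ i $ j * v $ j"
  by (simp add: diag_mat_def matrix_matrix_mult_def if_distrib [of "\<lambda>x. _ * x"] cong: if_cong)

lemma eigen_decomp_fun_unique:
  fixes f :: "real \<Rightarrow> real"
  assumes "eigen_decomp A V l" and "eigen_decomp A W m"
  shows "V ** diag_mat (\<chi> i. f (l $ i)) ** transpose V = W ** diag_mat (\<chi> i. f (m $ i)) ** transpose W"
proof -
  define U where "U = transpose W ** V"
  have V: "transpose V ** V = mat 1" "V ** transpose V = mat 1"
    and W: "transpose W ** W = mat 1" "W ** transpose W = mat 1"
    using assms by (auto simp: eigen_decomp_def orthogonal_matrix_def)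
  have WU: "W ** U = V"
    by (simp add: U_def matrix_mul_assoc W)
  have UV: "U ** transpose V = transpose W"
    unfolding U_def by (metis V(2) matrix_mul_assoc matrix_mul_rid)
  have "V ** diag_mat l ** transpose V = W ** diag_mat m ** transpose W"
    using assms by (simp add: eigen_decomp_def)
  then have "transpose W ** (V ** diag_mat l ** transpose V) ** V
      = transpose W ** (W ** diag_mat m ** transpose W) ** V"
    by simp
  moreover have "transpose W ** (V ** diag_mat l ** transpose V) ** V = U ** diag_mat l"
    unfolding U_def by (metis V(1) matrix_mul_assoc matrix_mul_rid)
  moreover have "transpose W ** (W ** diag_mat m ** transpose W) ** V = diag_mat m ** U"
    unfolding U_def by (metis W(1) matrix_mul_assoc matrix_mul_lid)
  ultimately have eq: "U ** diag_mat l = diag_mat m ** U" by simp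
  have "U $ i $ j * l $ j = m $ i * U $ i $ j" for i j
    using eq by (metis diag_mat_mult_left diag_mat_mult_right)
  then have "U $ i $ j * f (l $ j) = f (m $ i) * U $ i $ j" for i j
    by (metis mult.commute mult_cancel_left mult_zero_left)
  then have "U ** diag_mat (\<chi> i. f (l $ i)) = diag_mat (\<chi> i. f (m $ i)) ** U"
    by (simp add: vec_eq_iff diag_mat_mult_left diag_mat_mult_right)
  then show ?thesis
    by (metis UV WU matrix_mul_assoc)
qed

lemma pos_part_eqI:
  assumes "eigen_decomp A V ev"
  shows "pos_part A = V ** diag_mat (\<chi> i. if ev $ i > 0 then ev $ i else 0) ** transpose V"
  unfolding pos_part_def
proof (rule the_equality)
  show "\<exists>V' l. eigen_decomp A V' l \<and>
      V ** diag_mat (\<chi> i. if ev $ i > 0 then ev $ i else 0) ** transpose V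
      = V' ** diag_mat (\<chi> i. if l $ i > 0 then l $ i else 0) ** transpose V'"
    using assms by blast
qed (use eigen_decomp_fun_unique [OF assms, of _ _ "\<lambda>t. if t > 0 then t else 0"] in auto)

lemma neg_part_eqI:
  assumes "eigen_decomp A V ev"
  shows "neg_part A = V ** diag_mat (\<chi> i. if ev $ i < 0 then ev $ i else 0) ** transpose V"
  unfolding neg_part_def
proof (rule the_equality)
  show "\<exists>V' l. eigen_decomp A V' l \<and>
      V ** diag_mat (\<chi> i. if ev $ i < 0 then ev $ i else 0) ** transpose V
      = V' ** diag_mat (\<chi> i. if l $ i < 0 then l $ i else 0) ** transpose V'"
    using assms by blast
qed (use eigen_decomp_fun_unique [OF assms, of _ _ "\<lambda>t. if t < 0 then t else 0"] in auto)


section \<open>Triplet metric learning\<close>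

definition triplets :: "nat \<Rightarrow> (nat \<Rightarrow> 'c) \<Rightarrow> (nat \<times> nat \<times> nat) set" where
  "triplets n y = {(i, j, l). i \<in> {1..n} \<and> j \<in> {1..n} \<and> l \<in> {1..n} \<and>
     y i = y j \<and> i \<noteq> j \<and> y i \<noteq> y l}"

definition H_mat :: "(nat \<Rightarrow> real^'d) \<Rightarrow> nat \<times> nat \<times> nat \<Rightarrow> real^'d^'d" where
  "H_mat x = (\<lambda>(i, j, l). outer_prod (x i - x l) (x i - x l) - outer_prod (x i - x j) (x i - x j))"

text \<open>Hinge loss for \<open>\<gamma> = 0\<close>, smoothed hinge loss for \<open>\<gamma> > 0\<close>.\<close>

definition loss :: "real \<Rightarrow> real \<Rightarrow> real" where
  "loss \<gamma> x =
     (if \<gamma> = 0 then max 0 (1 - x)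
      else if x > 1 then 0
      else if 1 - \<gamma> \<le> x then 1 / (2 * \<gamma>) * (1 - x)^2
      else 1 - x - \<gamma> / 2)"

definition subdifferential :: "(real \<Rightarrow> real) \<Rightarrow> real \<Rightarrow> real set" where
  "subdifferential f a = {g. \<forall>z. f z \<ge> f a + g * (z - a)}"

definition primal ::
    "nat \<Rightarrow> (nat \<Rightarrow> real^'d) \<Rightarrow> (nat \<Rightarrow> 'c) \<Rightarrow> real \<Rightarrow> real \<Rightarrow> real^'d^'d \<Rightarrow> real" where
  "primal n x y \<gamma> lam M =
     (\<Sum>t\<in>triplets n y. loss \<gamma> (frob_inner M (H_mat x t))) + lam / 2 * (frob_norm M)^2"

definition is_subgradient ::
    "nat \<Rightarrow> (nat \<Rightarrow> real^'d) \<Rightarrow> (nat \<Rightarrow> 'c) \<Rightarrow> real \<Rightarrow> real \<Rightarrow> real^'d^'d \<Rightarrow> real^'d^'d \<Rightarrow> bool" where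
  "is_subgradient n x y \<gamma> lam M G \<longleftrightarrow>
     (\<exists>g. (\<forall>t\<in>triplets n y. g t \<in> subdifferential (loss \<gamma>) (frob_inner M (H_mat x t))) \<and>
          G = (\<Sum>t\<in>triplets n y. g t *\<^sub>R H_mat x t) + lam *\<^sub>R M)"


section \<open>The two bounds\<close>

text \<open>Each bound is a ball, given by its center and squared radius.
  \<open>G\<close> is the subgradient at the reference solution \<open>M\<close>.\<close>

definition pgb_center :: "real \<Rightarrow> real^'d^'d \<Rightarrow> real^'d^'d \<Rightarrow> real^'d^'d" where
  "pgb_center lam M G = pos_part (M - (1 / (2 * lam)) *\<^sub>R G)"

definition pgb_sq_radius :: "real \<Rightarrow> real^'d^'d \<Rightarrow> real^'d^'d \<Rightarrow> real" where
  "pgb_sq_radius lam M G =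
     (1 / (2 * lam) * frob_norm G)^2 - (frob_norm (neg_part (M - (1 / (2 * lam)) *\<^sub>R G)))^2"

definition rpb_center :: "real \<Rightarrow> real \<Rightarrow> real^'d^'d \<Rightarrow> real^'d^'d" where
  "rpb_center lam0 lam1 M0 = ((lam0 + lam1) / (2 * lam1)) *\<^sub>R M0"

definition rpb_sq_radius :: "real \<Rightarrow> real \<Rightarrow> real^'d^'d \<Rightarrow> real" where
  "rpb_sq_radius lam0 lam1 M0 = ((lam0 - lam1) / (2 * lam1) * frob_norm M0)^2"

end

theory Submission
  imports Defs
begin

text \<open>The loss is convex, so a separation argument turns the minimality of \<open>M\<^sub>0\<close> into
  \<open>g\<^sub>t \<in> \<partial>\<ell>(\<langle>M\<^sub>0, H\<^sub>t\<rangle>)\<close> such that \<open>S = \<Sum>g\<^sub>t H\<^sub>t + \<lambda>\<^sub>0 M\<^sub>0\<close> satisfies \<open>\<langle>S, M - M\<^sub>0\<rangle> \<ge> 0\<close> for all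
  positive semi-definite \<open>M\<close>. Hence \<open>S\<close> is positive semi-definite with \<open>\<langle>S, M\<^sub>0\<rangle> = 0\<close>, and
  therefore \<open>M\<^sub>0 S = 0\<close>. The same \<open>g\<^sub>t\<close> give the subgradient \<open>G = S + (\<lambda>\<^sub>1 - \<lambda>\<^sub>0) M\<^sub>0\<close> for \<open>\<lambda>\<^sub>1\<close>, and
  \<open>M\<^sub>0 - G / (2 \<lambda>\<^sub>1) = (\<lambda>\<^sub>0 + \<lambda>\<^sub>1) / (2 \<lambda>\<^sub>1) M\<^sub>0 - S / (2 \<lambda>\<^sub>1)\<close> is a difference of positive
  semi-definite matrices with zero product, so its two terms are its positive and negative parts.\<close>

section \<open>Eigenbases of self-adjoint maps\<close>

text \<open>Divide by \<open>t\<close> and let \<open>t\<close> tend to 0 from the right. This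
  extracts first-order conditions from inequalities along a segment.\<close>

lemma linear_coeff_nonneg:
  fixes a b :: real
  assumes "\<And>t. 0 < t \<Longrightarrow> t \<le> 1 \<Longrightarrow> 0 \<le> a * t + b * t\<^sup>2"
  shows "0 \<le> a"
proof -
  have "((\<lambda>t. a + b * t) \<longlongrightarrow> a + b * 0) (at_right 0)"
    by (intro tendsto_intros)
  moreover have "\<forall>\<^sub>F t in at_right 0. 0 \<le> a + b * t"
    unfolding eventually_at_right_field
  proof (intro exI [of _ 1] conjI allI impI)
    fix t :: real assume t: "0 < t" "t < 1"
    then have "0 \<le> t * (a + b * t)"
      using assms [of t] by (simp add: algebra_simps power2_eq_square)
    then show "0 \<le> a + b * t"
      using t by (simp add: zero_le_mult_iff)
  qed simp
  ultimately show ?thesis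
    using tendsto_lowerbound [of "\<lambda>t. a + b * t" "a + b * 0" "at_right 0" 0] by simp
qed

text \<open>Moving from \<open>u\<close> to \<open>u - t *\<^sub>R f u\<close> changes the quadratic
  form by \<open>- 2 * (f u \<bullet> f u) * t\<close> to first order. The form cannot drop below
  its value 0 at \<open>u\<close>, so \<open>f u\<close> vanishes.\<close>

lemma selfadjoint_nonneg_kernel:
  fixes f :: "'a::real_inner \<Rightarrow> 'a"
  assumes f: "linear f" and adj: "\<And>x y. f x \<bullet> y = x \<bullet> f y"
    and S: "subspace S" "f ` S \<subseteq> S" and nonneg: "\<And>x. x \<in> S \<Longrightarrow> 0 \<le> x \<bullet> f x"
    and u: "u \<in> S" "u \<bullet> f u = 0"
  shows "f u = 0"
proof -
  have "0 \<le> - 2 * (f u \<bullet> f u)"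
  proof (rule linear_coeff_nonneg)
    fix t :: real
    have "u - t *\<^sub>R f u \<in> S"
      using S u by (intro subspace_diff subspace_scale) auto
    then have "0 \<le> (u - t *\<^sub>R f u) \<bullet> f (u - t *\<^sub>R f u)"
      by (rule nonneg)
    also have "\<dots> = - 2 * (f u \<bullet> f u) * t + (f u \<bullet> f (f u)) * t\<^sup>2"
      using u(2) adj [of u "f u"]
      by (simp add: linear_diff [OF f] linear_scale [OF f] inner_diff_left inner_diff_right
          power2_eq_square algebra_simps)
    finally show "0 \<le> - 2 * (f u \<bullet> f u) * t + (f u \<bullet> f (f u)) * t\<^sup>2" .
  qed
  then show ?thesis
    by (metis inner_eq_zero_iff inner_ge_zero mult_minus_left neg_0_le_iff_le
        order_antisym zero_le_mult_iff zero_less_numeral not_le)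
qed

text \<open>A maximiser \<open>u\<close> of the Rayleigh quotient on the unit sphere of
  \<open>S\<close>, with maximum \<open>c\<close>, works: the form of
  \<open>c *\<^sub>R x - f x\<close> is nonnegative on \<open>S\<close> and zero at
  \<open>u\<close>, so \<open>u\<close> lies in the kernel of that map.\<close>

lemma selfadjoint_eigenvector:
  fixes f :: "'a::euclidean_space \<Rightarrow> 'a"
  assumes f: "linear f" and adj: "\<And>x y. f x \<bullet> y = x \<bullet> f y"
    and S: "subspace S" "f ` S \<subseteq> S" "S \<noteq> {0}"
  obtains u c where "u \<in> S" "norm u = 1" "f u = c *\<^sub>R u"
proof -
  let ?K = "S \<inter> sphere 0 1"
  have "compact ?K"
    using S(1) by (simp add: closed_Int_compact closed_subspace)
  moreover have "?K \<noteq> {}"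
  proof -
    obtain w where w: "w \<in> S" "w \<noteq> 0"
      using S by (metis subspace_0 equals0D insertI1 subsetI subset_singletonD singletonD)
    then have "w /\<^sub>R norm w \<in> ?K"
      using S(1) by (auto simp: subspace_scale)
    then show ?thesis by blast
  qed
  moreover have "continuous_on ?K (\<lambda>x. x \<bullet> f x)"
    using f by (intro continuous_on_inner continuous_on_id linear_continuous_on)
      (simp add: linear_conv_bounded_linear)
  ultimately obtain u where u: "u \<in> ?K" and max: "\<forall>x\<in>?K. x \<bullet> f x \<le> u \<bullet> f u"
    using continuous_attains_sup [of ?K "\<lambda>x. x \<bullet> f x"] by blast
  define c where "c = u \<bullet> f u"
  define g where "g = (\<lambda>x. c *\<^sub>R x - f x)"
  have "g u = 0"
  proof (rule selfadjoint_nonneg_kernel [where f = g and S = S])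
    show "linear g"
      unfolding g_def using f by (intro linear_compose_sub linear_scaleR)
    show "g x \<bullet> y = x \<bullet> g y" for x y
      by (simp add: g_def inner_diff_left inner_diff_right adj)
    show "g ` S \<subseteq> S"
      using S by (auto simp: g_def intro!: subspace_diff subspace_scale)
    show "0 \<le> x \<bullet> g x" if "x \<in> S" for x
    proof (cases "x = 0")
      case False
      then have "x /\<^sub>R norm x \<in> ?K"
        using that S(1) by (auto simp: subspace_scale)
      from bspec [OF max this] False have "(x \<bullet> f x) \<le> c * (norm x)\<^sup>2"
        by (simp add: linear_scale [OF f] c_def field_simps power2_eq_square)
      then show ?thesis
        by (simp add: g_def inner_diff_right power2_norm_eq_inner)
    qed simp
    show "u \<bullet> g u = 0"
      using u by (simp add: g_def c_def inner_diff_right flip: power2_norm_eq_inner)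
  qed (use S u in auto)
  then show thesis
    using that [of u c] u by (simp add: g_def)
qed

text \<open>Induction on the dimension: split off a unit eigenvector \<open>u\<close>. By
  self-adjointness its orthogonal complement \<open>T\<close> within \<open>S\<close> is again
  invariant under \<open>f\<close>.\<close>

lemma selfadjoint_orthonormal_eigenbasis:
  fixes f :: "'a::euclidean_space \<Rightarrow> 'a"
  assumes f: "linear f" and adj: "\<And>x y. f x \<bullet> y = x \<bullet> f y"
    and "subspace S" "f ` S \<subseteq> S"
  shows "\<exists>B\<subseteq>S. S \<subseteq> span B \<and> pairwise orthogonal B \<and> (\<forall>b\<in>B. norm b = 1 \<and> (\<exists>c. f b = c *\<^sub>R b))"
  using assms(3,4)
proof (induction "dim S" arbitrary: S rule: less_induct)
  case less
  show ?case
  proof (cases "S = {0}")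
    case True
    then show ?thesis by (intro exI [of _ "{}"]) auto
  next
    case False
    then obtain u c where u: "u \<in> S" "norm u = 1" "f u = c *\<^sub>R u"
      using selfadjoint_eigenvector [OF f adj less.prems] by metis
    have uu: "u \<bullet> u = 1"
      using u(2) by (simp add: norm_eq_1)
    define T where "T = S \<inter> {w. u \<bullet> w = 0}"
    have T: "subspace T"
      unfolding T_def by (intro subspace_inter less.prems(1) subspace_hyperplane)
    have "f ` T \<subseteq> T"
      using less.prems(2) u(3) by (auto simp: T_def simp flip: adj)
    moreover have "dim T < dim S"
    proof -
      have "u \<notin> T" using uu by (simp add: T_def)
      then have "T \<subset> S" using u(1) unfolding T_def by blast
      then show ?thesis
        using T less.prems(1) by (metis dim_psubset span_eq_iff)
    qed
    ultimately obtain B where B: "B \<subseteq> T" "T \<subseteq> span B" "pairwise orthogonal B"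
      "\<forall>b\<in>B. norm b = 1 \<and> (\<exists>c. f b = c *\<^sub>R b)"
      using less.hyps [OF _ T] by metis
    have "S \<subseteq> span (insert u B)"
    proof
      fix w assume "w \<in> S"
      then have "w - (u \<bullet> w) *\<^sub>R u \<in> T"
        using less.prems(1) u(1) uu
        by (simp add: T_def inner_diff_right subspace_diff subspace_scale)
      then have "w - (u \<bullet> w) *\<^sub>R u \<in> span (insert u B)"
        using B(2) span_mono [of B "insert u B"] by blast
      then show "w \<in> span (insert u B)"
        by (metis diff_add_cancel insertI1 span_add span_base span_scale)
    qed
    moreover have "pairwise orthogonal (insert u B)"
      using B by (auto simp: pairwise_insert T_def orthogonal_def inner_commute)
    ultimately show ?thesis
      using B u by (intro exI [of _ "insert u B"]) (auto simp: T_def)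
  qed
qed

lemma inner_matrix_vector_symmetric:
  fixes A :: "real^'d^'d"
  assumes "transpose A = A"
  shows "(A *v v) \<bullet> w = v \<bullet> (A *v w)"
  using dot_lmul_matrix [of v A w] by (metis assms vector_transpose_matrix)

lemma eigen_columns_imp_eq:
  assumes V: "orthogonal_matrix V" and eig: "\<And>j. A *v column j V = ev $ j *\<^sub>R column j V"
  shows "A = V ** diag_mat ev ** transpose V"
proof -
  have "(A ** V) $ i $ j = (A *v column j V) $ i" for i j
    by (simp add: column_def matrix_matrix_mult_def matrix_vector_mult_def)
  then have "A ** V = V ** diag_mat ev"
    by (simp add: vec_eq_iff diag_mat_mult_right eig) (simp add: column_def)
  then show ?thesis
    using V unfolding orthogonal_matrix_def by (metis matrix_mul_assoc matrix_mul_rid)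
qed

text \<open>Spectral theorem for real symmetric matrices. An orthonormal eigenbasis has
  \<open>CARD('d)\<close> elements, so \<open>'d\<close> can index it, and its members become the
  columns of \<open>V\<close>.\<close>

lemma eigen_decomp_exists:
  fixes A :: "real^'d^'d"
  assumes A: "transpose A = A"
  obtains V ev where "eigen_decomp A V ev"
proof -
  obtain B where B: "UNIV \<subseteq> span B" "pairwise orthogonal B"
    "\<forall>b\<in>B. norm b = 1 \<and> (\<exists>c. A *v b = c *\<^sub>R b)"
    using selfadjoint_orthonormal_eigenbasis [of "(*v) A" UNIV]
      inner_matrix_vector_symmetric [OF A] by (metis matrix_vector_mul_linear subset_UNIV subspace_UNIV)
  have "independent B"
    using B by (intro pairwise_orthogonal_independent) auto
  then have "finite B"
    by (simp add: independent_bound)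
  have "span B = span UNIV"
    using B(1) by (simp add: top.extremum_unique)
  then have "card B = CARD('d)"
    using dim_eq_card [of B UNIV] \<open>independent B\<close> by simp
  then obtain b where b: "bij_betw b (UNIV :: 'd set) B"
    using \<open>finite B\<close> finite_same_card_bij [of "UNIV :: 'd set" B] by auto
  then have bB: "b i \<in> B" for i
    by (auto simp: bij_betw_def)
  have "\<forall>i. \<exists>c. A *v b i = c *\<^sub>R b i"
    using B(3) bB by blast
  from choice [OF this] obtain ev where ev: "\<And>i. A *v b i = ev i *\<^sub>R b i"
    by blast
  define V :: "real^'d^'d" where "V = (\<chi> i j. b j $ i)"
  have col: "column j V = b j" for j
    by (simp add: V_def column_def vec_eq_iff)
  have "orthogonal (b i) (b j)" if "i \<noteq> j" for i j
  proof -
    have "b i \<noteq> b j" using b that by (auto simp: bij_betw_def inj_def)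
    then show ?thesis using pairwiseD [OF B(2) bB bB] by simp
  qed
  then have V: "orthogonal_matrix V"
    using B(3) bB by (simp add: orthogonal_matrix_orthonormal_columns col)
  then have "A = V ** diag_mat (\<chi> i. ev i) ** transpose V"
    using ev by (intro eigen_columns_imp_eq) (simp_all add: col)
  then show thesis
    using that V unfolding eigen_decomp_def by blast
qed

section \<open>Linearising a sum of convex losses at a minimiser\<close>

text \<open>The separated sets are the points \<open>(f M - f M0, s)\<close> with \<open>s \<ge> h M - h M0\<close> and the strict
  hypograph of \<open>r \<mapsto> \<phi> (f M0) - \<phi> (f M0 + r)\<close>; the slope of the separating line is the subgradient.\<close>

lemma convex_minimizer_linearize:
  fixes f :: "'a::real_vector \<Rightarrow> real"
  assumes f: "linear f" and h: "convex_on C h" and phi: "convex_on UNIV \<phi>"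
    and M0: "M0 \<in> C" and min: "\<And>M. M \<in> C \<Longrightarrow> \<phi> (f M0) + h M0 \<le> \<phi> (f M) + h M"
  obtains g where "g \<in> subdifferential \<phi> (f M0)"
    and "\<And>M. M \<in> C \<Longrightarrow> g * f M0 + h M0 \<le> g * f M + h M"
proof -
  define S where "S = {(f M - f M0, s) |M s. M \<in> C \<and> h M - h M0 \<le> s}"
  define T where "T = {(r, s). s < \<phi> (f M0) - \<phi> (f M0 + r)}"
  have "convex C" using h by (simp add: convex_on_def)
  have "convex S"
  proof (rule convexI)
    fix p q and u v :: real
    assume "p \<in> S" "q \<in> S" and uv: "0 \<le> u" "0 \<le> v" "u + v = 1"
    then obtain M s M' s' where p: "p = (f M - f M0, s)" "M \<in> C" "h M - h M0 \<le> s"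
      and q: "q = (f M' - f M0, s')" "M' \<in> C" "h M' - h M0 \<le> s'"
      by (auto simp: S_def)
    let ?M = "u *\<^sub>R M + v *\<^sub>R M'"
    have v: "v = 1 - u" using uv by simp
    have "h ?M - h M0 \<le> u * (h M - h M0) + v * (h M' - h M0)"
    proof -
      have "h ?M \<le> u * h M + v * h M'"
        using h p(2) q(2) uv by (auto simp: convex_on_def)
      then show ?thesis unfolding v by (simp add: algebra_simps)
    qed
    also have "\<dots> \<le> u * s + v * s'"
      using p q uv by (intro add_mono mult_left_mono) auto
    finally have "h ?M - h M0 \<le> u * s + v * s'" .
    moreover have "?M \<in> C"
      using \<open>convex C\<close> p q uv by (auto simp: convex_def)
    moreover have "f ?M - f M0 = u * (f M - f M0) + v * (f M' - f M0)"
      by (simp only: linear_add [OF f] linear_scale [OF f]) (simp add: v algebra_simps)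
    ultimately show "u *\<^sub>R p + v *\<^sub>R q \<in> S"
      unfolding S_def p(1) q(1) by (auto intro!: exI [of _ ?M])
  qed
  moreover have "convex T"
  proof (rule convexI)
    fix p q and u v :: real
    assume pq: "p \<in> T" "q \<in> T" and uv: "0 \<le> u" "0 \<le> v" "u + v = 1"
    obtain r s r' s' where p: "p = (r, s)" "q = (r', s')" by fastforce
    have v: "v = 1 - u" using uv by simp
    have "u * s + v * s' < u * (\<phi> (f M0) - \<phi> (f M0 + r)) + v * (\<phi> (f M0) - \<phi> (f M0 + r'))"
    \<comment> \<open>Strictness comes from the first summand; if its weight vanishes, then
      \<open>v = 1\<close> and the second one supplies it.\<close>
    proof (cases "u = 0")
      case False
      then show ?thesis
        using pq p uv by (intro add_less_le_mono mult_left_mono mult_strict_left_mono) (auto simp: T_def)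
    qed (use pq p uv in \<open>auto simp: T_def\<close>)
    also have "\<dots> \<le> \<phi> (f M0) - \<phi> (u * (f M0 + r) + v * (f M0 + r'))"
    proof -
      have "\<phi> (u * (f M0 + r) + v * (f M0 + r')) \<le> u * \<phi> (f M0 + r) + v * \<phi> (f M0 + r')"
        using phi uv by (auto simp: convex_on_def)
      then show ?thesis unfolding v by (simp add: algebra_simps)
    qed
    also have "u * (f M0 + r) + v * (f M0 + r') = f M0 + (u * r + v * r')"
      unfolding v by (simp add: algebra_simps)
    finally show "u *\<^sub>R p + v *\<^sub>R q \<in> T"
      by (simp add: T_def p)
  qed
  moreover have S0: "(0, 0) \<in> S" and Tneg: "\<And>e. e < 0 \<Longrightarrow> (0, e) \<in> T"
    using M0 by (force simp: S_def T_def)+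
  moreover have "S \<inter> T = {}"
    using min by (fastforce simp: S_def T_def)
  ultimately obtain a b where a: "a \<noteq> 0" "\<forall>z\<in>T. a \<bullet> z \<le> b" "\<forall>z\<in>S. b \<le> a \<bullet> z"
    using separating_hyperplane_sets [of T S]
    by (metis Int_commute empty_iff zero_less_one neg_less_0_iff_less)
  obtain p q where pq: "a = (p, q)" by fastforce
  have sepT: "p * r + q * s \<le> b" if "s < \<phi> (f M0) - \<phi> (f M0 + r)" for r s
    using a(2) that by (force simp: T_def pq)
  have sepS: "b \<le> p * (f M - f M0) + q * s" if "M \<in> C" "h M - h M0 \<le> s" for M s
    using a(3) that by (force simp: S_def pq)
  have "b \<le> 0" using sepS [OF M0, of 0] by simp
  \<comment> \<open>\<open>S\<close> contains the whole ray \<open>(0, s)\<close> with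
    \<open>s \<ge> 0\<close>, on which a negative \<open>q\<close> would make the functional
    unbounded below.\<close>
  have "0 \<le> q"
  proof (rule ccontr)
    assume "\<not> 0 \<le> q"
    then have "q * ((b - 1) / q) = b - 1" and "0 \<le> (b - 1) / q"
      using \<open>b \<le> 0\<close> by (auto simp: divide_nonpos_neg)
    then show False using sepS [OF M0, of "(b - 1) / q"] by simp
  qed
  moreover have "q \<noteq> 0"
  proof
    assume "q = 0"
    then have "p \<noteq> 0" using a(1) pq by (simp add: zero_prod_def)
    moreover have "p * ((b + 1) / p) \<le> b"
      using sepT [of _ "(b + 1) / p", OF lt_ex [THEN someI_ex]] \<open>q = 0\<close> by simp
    ultimately show False by simp
  qed
  ultimately have q: "0 < q" by simp
  have "0 \<le> b"
  proof (rule ccontr)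
    assume "\<not> 0 \<le> b"
    then show False
      using sepT [of "b / (2 * q)" 0] q by (simp add: divide_neg_pos)
  qed
  with \<open>b \<le> 0\<close> have b: "b = 0" by simp
  show thesis
  proof
    show "p / q \<in> subdifferential \<phi> (f M0)"
      unfolding subdifferential_def
    proof (intro CollectI allI, rule ccontr)
      fix z assume neg: "\<not> \<phi> (f M0) + p / q * (z - f M0) \<le> \<phi> z"
      let ?r = "z - f M0"
      \<comment> \<open>If the subgradient inequality failed at \<open>z\<close>, a point
        \<open>(z - f M0, s)\<close> of \<open>T\<close> would lie strictly above the separating
        line through the origin.\<close>
      obtain s where s: "- (p / q * ?r) < s" "s < \<phi> (f M0) - \<phi> z"
        using neg dense [of "- (p / q * ?r)" "\<phi> (f M0) - \<phi> z"] by auto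
      have "p * ?r + q * s \<le> 0"
        using sepT [of s ?r] s(2) b by simp
      moreover have "q * (- (p / q * ?r)) < q * s"
        using s(1) q by (rule mult_strict_left_mono)
      ultimately show False using q by simp
    qed
    show "p / q * f M0 + h M0 \<le> p / q * f M + h M" if "M \<in> C" for M
    proof -
      have "0 \<le> p * (f M - f M0) + q * (h M - h M0)"
        using sepS [OF that order_refl] b by simp
      then have "0 \<le> (p * (f M - f M0) + q * (h M - h M0)) / q"
        using q by simp
      also have "\<dots> = (p / q * f M + h M) - (p / q * f M0 + h M0)"
        using q by (simp add: field_simps)
      finally show ?thesis by simp
    qed
  qed
qed

lemma convex_on_sum_fun:
  assumes "convex C" "\<And>t. t \<in> T \<Longrightarrow> convex_on C (F t)"
  shows "convex_on C (\<lambda>x. \<Sum>t\<in>T. F t x)"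
  using assms(2)
proof (induction T rule: infinite_finite_induct)
  case (insert t T)
  then show ?case by (simp add: convex_on_add)
qed (use \<open>convex C\<close> in \<open>simp_all add: convex_on_const\<close>)

lemma convex_on_compose_linear:
  fixes f :: "'a::real_vector \<Rightarrow> real"
  assumes f: "linear f" and "convex_on UNIV \<phi>" "convex C"
  shows "convex_on C (\<lambda>x. \<phi> (f x))"
  using assms by (simp add: convex_on_def linear_add linear_scale)

text \<open>One summand is linearised at a time. The other summands are first absorbed into the
  convex remainder; afterwards the new linear term joins \<open>h\<close>, which is why the
  induction leaves \<open>h\<close> arbitrary.\<close>

lemma convex_sum_minimizer_linearize:
  fixes f :: "'t \<Rightarrow> 'a::real_vector \<Rightarrow> real"
  assumes "finite T" and f: "\<And>t. t \<in> T \<Longrightarrow> linear (f t)"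
    and phi: "convex_on UNIV \<phi>" and h: "convex_on C h" and M0: "M0 \<in> C"
    and "\<And>M. M \<in> C \<Longrightarrow> (\<Sum>t\<in>T. \<phi> (f t M0)) + h M0 \<le> (\<Sum>t\<in>T. \<phi> (f t M)) + h M"
  shows "\<exists>g. (\<forall>t\<in>T. g t \<in> subdifferential \<phi> (f t M0)) \<and>
    (\<forall>M\<in>C. (\<Sum>t\<in>T. g t * f t M0) + h M0 \<le> (\<Sum>t\<in>T. g t * f t M) + h M)"
  using assms(1,2,4,6)
proof (induction T arbitrary: h)
  case (insert t T)
  have C: "convex C" using insert.prems(2) by (simp add: convex_on_def)
  have "convex_on C (\<lambda>M. (\<Sum>t\<in>T. \<phi> (f t M)) + h M)"
  proof (rule convex_on_add)
    show "convex_on C (\<lambda>M. \<Sum>t\<in>T. \<phi> (f t M))"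
      using insert.prems(1) convex_on_compose_linear [OF _ phi C]
      by (intro convex_on_sum_fun C) simp
  qed (rule insert.prems(2))
  then obtain c where c: "c \<in> subdifferential \<phi> (f t M0)"
    and min: "\<And>M. M \<in> C \<Longrightarrow> c * f t M0 + ((\<Sum>t\<in>T. \<phi> (f t M0)) + h M0)
      \<le> c * f t M + ((\<Sum>t\<in>T. \<phi> (f t M)) + h M)"
    using convex_minimizer_linearize [of "f t" C "\<lambda>M. (\<Sum>t\<in>T. \<phi> (f t M)) + h M" \<phi> M0]
      insert.prems insert.hyps phi M0 by (auto simp: add.assoc)
  have "convex_on C (\<lambda>M. c * f t M + h M)"
    using insert.prems C
    by (auto intro!: convex_on_add simp: convex_on_def linear_add linear_scale algebra_simps)
  then obtain g where g: "\<forall>t\<in>T. g t \<in> subdifferential \<phi> (f t M0)"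
    "\<forall>M\<in>C. (\<Sum>t\<in>T. g t * f t M0) + (c * f t M0 + h M0) \<le> (\<Sum>t\<in>T. g t * f t M) + (c * f t M + h M)"
    using insert.IH [of "\<lambda>M. c * f t M + h M"] insert.prems min by (auto simp: algebra_simps)
  have sum_eq: "(\<Sum>s\<in>T. (g(t := c)) s * f s M) = (\<Sum>s\<in>T. g s * f s M)" for M
    using insert.hyps by (intro sum.cong) auto
  show ?case
  proof (intro exI [of _ "g(t := c)"] conjI ballI)
    show "(g(t := c)) s \<in> subdifferential \<phi> (f s M0)" if "s \<in> insert t T" for s
      using that g(1) c by auto
    show "(\<Sum>s\<in>insert t T. (g(t := c)) s * f s M0) + h M0
        \<le> (\<Sum>s\<in>insert t T. (g(t := c)) s * f s M) + h M" if "M \<in> C" for M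
      using g(2) that insert.hyps
      by (simp add: sum_eq del: fun_upd_apply) (simp add: algebra_simps)
  qed
qed auto

section \<open>Positive semi-definite matrices\<close>

lemma psd_kernel:
  assumes "psd A" "v \<bullet> (A *v v) = 0"
  shows "A *v v = 0"
  using assms inner_matrix_vector_symmetric [of A]
  by (intro selfadjoint_nonneg_kernel [where f = "(*v) A" and S = UNIV]) (auto simp: psd_def)

lemma psd_zero: "psd 0"
  by (simp add: psd_def transpose_def vec_eq_iff)

lemma transpose_add: "transpose (A + B :: real^'m^'n) = transpose A + transpose B"
  and transpose_minus: "transpose (A - B :: real^'m^'n) = transpose A - transpose B"
  and transpose_scaleR: "transpose (c *\<^sub>R A :: real^'m^'n) = c *\<^sub>R transpose A"
  by (simp_all add: transpose_def vec_eq_iff)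

lemma transpose_sum: "transpose (\<Sum>t\<in>T. F t :: real^'m^'n) = (\<Sum>t\<in>T. transpose (F t))"
  by (simp add: transpose_def vec_eq_iff)

lemma psd_add: "psd A \<Longrightarrow> psd B \<Longrightarrow> psd (A + B)"
  by (simp add: psd_def transpose_add matrix_vector_mult_add_rdistrib inner_add_right)

lemma psd_scaleR: "psd A \<Longrightarrow> 0 \<le> c \<Longrightarrow> psd (c *\<^sub>R A)"
  by (simp add: psd_def transpose_scaleR flip: scaleR_matrix_vector_assoc)

lemma convex_psd: "convex {M. psd M}"
  by (auto intro!: convexI psd_add psd_scaleR)

lemma transpose_outer_prod [simp]: "transpose (outer_prod v v) = outer_prod v v"
  by (simp add: outer_prod_def transpose_def vec_eq_iff mult.commute)

lemma inner_outer_prod: "A \<bullet> outer_prod u v = u \<bullet> (A *v v)"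
  by (simp add: outer_prod_def inner_vec_def matrix_vector_mult_def sum_distrib_left mult.assoc
      mult.left_commute mult.commute)

lemma outer_prod_mult: "outer_prod u v *v w = (v \<bullet> w) *\<^sub>R u"
  by (simp add: vec_eq_iff outer_prod_def matrix_vector_mult_def inner_vec_def sum_distrib_left
      sum_distrib_right mult.assoc mult.left_commute mult.commute)

lemma psd_outer_prod: "psd (outer_prod v v)"
  by (simp add: psd_def outer_prod_mult inner_commute [of _ v])

lemma eigen_decomp_column:
  assumes "eigen_decomp A V ev"
  shows "A *v column j V = ev $ j *\<^sub>R column j V" and "norm (column j V) = 1"
proof -
  have V: "orthogonal_matrix V" and A: "A = V ** diag_mat ev ** transpose V"
    using assms by (auto simp: eigen_decomp_def)
  then have "A ** V = V ** diag_mat ev"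
    unfolding orthogonal_matrix by (metis matrix_mul_assoc matrix_mul_rid)
  moreover have "(A *v column j V) $ i = (A ** V) $ i $ j" for i
    by (simp add: column_def matrix_matrix_mult_def matrix_vector_mult_def)
  ultimately show "A *v column j V = ev $ j *\<^sub>R column j V"
    by (simp add: vec_eq_iff diag_mat_mult_right column_def)
  show "norm (column j V) = 1"
    using V by (simp add: orthogonal_matrix_orthonormal_columns)
qed

text \<open>Eigenvalues are nonnegative, being values of the quadratic form at unit eigenvectors, so
  \<open>R\<close> can be \<open>V\<close> times the diagonal matrix of their square roots.\<close>

lemma psd_factor:
  fixes A :: "real^'d^'d"
  assumes "psd A"
  obtains R :: "real^'d^'d" where "A = R ** transpose R"
proof -
  obtain V ev where dec: "eigen_decomp A V ev"
    using assms eigen_decomp_exists unfolding psd_def by blast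
  have "0 \<le> ev $ j" for j
  proof -
    have "0 \<le> column j V \<bullet> (A *v column j V)"
      using assms by (simp add: psd_def)
    then show ?thesis
      using eigen_decomp_column [OF dec, of j] by (simp add: norm_eq_1)
  qed
  define D where "D = diag_mat (\<chi> j. sqrt (ev $ j))"
  have "transpose D = D"
    by (simp add: D_def diag_mat_def transpose_def vec_eq_iff)
  moreover have "D ** D = diag_mat ev"
    unfolding D_def using \<open>\<And>j. 0 \<le> ev $ j\<close>
    by (simp add: vec_eq_iff diag_mat_mult_left) (simp add: diag_mat_def)
  ultimately have "A = (V ** D) ** transpose (V ** D)"
    using dec unfolding eigen_decomp_def matrix_transpose_mul by (metis matrix_mul_assoc)
  then show thesis by (rule that)
qed

lemma inner_mult_transpose:
  fixes S R :: "real^'d^'d"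
  shows "S \<bullet> (R ** transpose R) = (\<Sum>j\<in>UNIV. column j R \<bullet> (S *v column j R))"
proof -
  have "S \<bullet> (R ** transpose R) = (\<Sum>i\<in>UNIV. \<Sum>k\<in>UNIV. \<Sum>j\<in>UNIV. R $ i $ j * (S $ i $ k * R $ k $ j))"
    by (simp add: inner_vec_def matrix_matrix_mult_def transpose_def sum_distrib_left mult.left_commute)
  also have "\<dots> = (\<Sum>i\<in>UNIV. \<Sum>j\<in>UNIV. \<Sum>k\<in>UNIV. R $ i $ j * (S $ i $ k * R $ k $ j))"
    by (intro sum.cong refl sum.swap)
  also have "\<dots> = (\<Sum>j\<in>UNIV. \<Sum>i\<in>UNIV. \<Sum>k\<in>UNIV. R $ i $ j * (S $ i $ k * R $ k $ j))"
    by (rule sum.swap)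
  finally show ?thesis
    by (simp add: inner_vec_def matrix_vector_mult_def column_def sum_distrib_left)
qed

text \<open>Complementary slackness: with \<open>M = R ** transpose R\<close> the inner product is a
  sum of nonnegative values of the form of \<open>S\<close> at the columns of \<open>R\<close>. All
  of them vanish, so \<open>S\<close> kills every column.\<close>

lemma psd_inner_zero_imp_mult_zero:
  fixes S M :: "real^'d^'d"
  assumes S: "psd S" and M: "psd M" and "S \<bullet> M = 0"
  shows "S ** M = 0"
proof -
  obtain R :: "real^'d^'d" where R: "M = R ** transpose R"
    using psd_factor [OF M] .
  have "(\<Sum>j\<in>UNIV. column j R \<bullet> (S *v column j R)) = 0"
    using assms(3) by (simp add: R inner_mult_transpose)
  then have "column j R \<bullet> (S *v column j R) = 0" for j
    using S by (simp add: sum_nonneg_eq_0_iff psd_def)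
  then have "S *v column j R = 0" for j
    using psd_kernel [OF S] by blast
  moreover have "(S ** R) $ i $ j = (S *v column j R) $ i" for i j
    by (simp add: column_def matrix_matrix_mult_def matrix_vector_mult_def)
  ultimately have "S ** R = 0"
    by (simp add: vec_eq_iff)
  then show ?thesis
    unfolding R by (simp add: matrix_mul_assoc)
qed

text \<open>On an eigenvector \<open>v\<close> of \<open>A - B\<close> with eigenvalue \<open>l\<close>, the relation \<open>A ** B = 0\<close> gives
  \<open>A (A v) = l A v\<close> and \<open>B (B v) = - l B v\<close>, so the sign of \<open>l\<close> decides which of \<open>A v\<close>, \<open>B v\<close>
  vanishes.\<close>

lemma pos_neg_part_diff:
  assumes A: "psd A" and B: "psd B" and AB: "A ** B = 0"
  shows "pos_part (A - B) = A" and "neg_part (A - B) = - B"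
proof -
  have sym: "transpose A = A" "transpose B = B"
    using A B by (auto simp: psd_def)
  have BA: "B ** A = 0"
    using arg_cong [OF AB, of transpose] sym
    by (simp add: matrix_transpose_mul) (simp add: transpose_def vec_eq_iff)
  obtain V ev where dec: "eigen_decomp (A - B) V ev"
    using eigen_decomp_exists [of "A - B"] sym by (auto simp: transpose_minus)
  then have V: "orthogonal_matrix V"
    by (simp add: eigen_decomp_def)
  have eigA: "A *v column j V = (if ev $ j > 0 then ev $ j else 0) *\<^sub>R column j V"
    and eigB: "(- B) *v column j V = (if ev $ j < 0 then ev $ j else 0) *\<^sub>R column j V" for j
  proof -
    let ?v = "column j V" and ?l = "ev $ j"
    have v: "A *v ?v - B *v ?v = ?l *\<^sub>R ?v"
      using eigen_decomp_column(1) [OF dec, of j] by (simp add: matrix_vector_mult_diff_rdistrib)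
    have AAv: "A *v (A *v ?v) = ?l *\<^sub>R (A *v ?v)"
      using arg_cong [OF v, of "(*v) A"] AB
      by (simp add: matrix_vector_mult_diff_distrib matrix_vector_mul_assoc matrix_vector_mult_scaleR)
    have "- (B *v (B *v ?v)) = ?l *\<^sub>R (B *v ?v)"
      using arg_cong [OF v, of "(*v) B"] BA
      by (simp add: matrix_vector_mult_diff_distrib matrix_vector_mul_assoc matrix_vector_mult_scaleR)
    then have BBv: "B *v (B *v ?v) = - ?l *\<^sub>R (B *v ?v)"
      by (metis minus_minus scaleR_minus_left)
    have B0: "B *v ?v = 0" if "?l > 0"
    proof -
      have "0 \<le> (B *v ?v) \<bullet> (B *v (B *v ?v))"
        using B by (simp add: psd_def)
      then have "?l * ((B *v ?v) \<bullet> (B *v ?v)) \<le> 0"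
        unfolding BBv by simp
      then show ?thesis
        using that by (metis inner_gt_zero_iff mult_pos_pos not_le)
    qed
    have A0: "A *v ?v = 0" if "?l \<le> 0"
    proof (cases "?l = 0")
      \<comment> \<open>Here the sign of \<open>l\<close> gives nothing. Symmetry does: the squared
        norm of \<open>A v\<close> equals the inner product of \<open>v\<close> with
        \<open>A (A v)\<close>, which is 0.\<close>
      case True
      then have "A *v (A *v ?v) = 0" using AAv by simp
      then have "(A *v ?v) \<bullet> (A *v ?v) = 0"
        by (simp add: inner_matrix_vector_symmetric [OF sym(1)])
      then show ?thesis by simp
    next
      case False
      have "0 \<le> (A *v ?v) \<bullet> (A *v (A *v ?v))"
        using A by (simp add: psd_def)
      then have "0 \<le> ?l * ((A *v ?v) \<bullet> (A *v ?v))"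
        unfolding AAv by simp
      then show ?thesis
        using that False by (metis inner_gt_zero_iff mult_neg_pos not_le order_le_less)
    qed
    show "A *v ?v = (if ?l > 0 then ?l else 0) *\<^sub>R ?v"
      using v A0 B0 by auto
    have "(- B) *v ?v = - (B *v ?v)"
      by (simp add: vec_eq_iff matrix_vector_mult_def sum_negf)
    then show "(- B) *v ?v = (if ?l < 0 then ?l else 0) *\<^sub>R ?v"
      using v A0 B0 by (cases "?l = 0") (auto simp: not_less)
  qed
  show "pos_part (A - B) = A"
    unfolding pos_part_eqI [OF dec] using eigA
    by (intro eigen_columns_imp_eq [symmetric] V) simp
  show "neg_part (A - B) = - B"
    unfolding neg_part_eqI [OF dec] using eigB
    by (intro eigen_columns_imp_eq [symmetric] V) simp
qed

text \<open>One half of the self-duality of the cone: testing against rank-one matrices recovers the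
  quadratic form.\<close>

lemma dual_psd_cone:
  assumes "transpose S = S" "\<And>M. psd M \<Longrightarrow> 0 \<le> S \<bullet> M"
  shows "psd S"
  using assms(2) [OF psd_outer_prod] by (simp add: psd_def assms(1) inner_outer_prod)

section \<open>Optimality conditions\<close>

text \<open>The claim is the first-order coefficient in \<open>t\<close> of the objective along the
  segment from \<open>M0\<close> to \<open>M\<close>.\<close>

lemma regularized_minimizer_variational:
  fixes L M0 :: "'a::real_inner"
  assumes C: "convex C" "M0 \<in> C" "M \<in> C"
    and min: "\<And>M. M \<in> C \<Longrightarrow> L \<bullet> M0 + c / 2 * (norm M0)\<^sup>2 \<le> L \<bullet> M + c / 2 * (norm M)\<^sup>2"
  shows "0 \<le> (L + c *\<^sub>R M0) \<bullet> (M - M0)"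
proof (rule linear_coeff_nonneg)
  fix t :: real assume t: "0 < t" "t \<le> 1"
  have "(1 - t) *\<^sub>R M0 + t *\<^sub>R M \<in> C"
    using C t by (auto simp: convex_alt)
  also have "(1 - t) *\<^sub>R M0 + t *\<^sub>R M = M0 + t *\<^sub>R (M - M0)"
    by (simp add: algebra_simps)
  finally have "L \<bullet> M0 + c / 2 * (norm M0)\<^sup>2
      \<le> L \<bullet> (M0 + t *\<^sub>R (M - M0)) + c / 2 * (norm (M0 + t *\<^sub>R (M - M0)))\<^sup>2"
    by (rule min)
  also have "(norm (M0 + t *\<^sub>R (M - M0)))\<^sup>2
      = (norm M0)\<^sup>2 + 2 * t * (M0 \<bullet> (M - M0)) + t\<^sup>2 * (norm (M - M0))\<^sup>2"
    unfolding power2_norm_eq_inner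
    by (simp only: inner_add_left inner_add_right inner_scaleR_left inner_scaleR_right
        inner_commute [of "M - M0" M0]) (simp add: power2_eq_square algebra_simps)
  finally show "0 \<le> (L + c *\<^sub>R M0) \<bullet> (M - M0) * t + (c / 2 * (norm (M - M0))\<^sup>2) * t\<^sup>2"
    by (simp only: inner_add_left inner_add_right inner_scaleR_left inner_scaleR_right)
      (simp add: algebra_simps)
qed

section \<open>Convexity of the loss and of the squared norm\<close>

text \<open>Fenchel-Young inequality for the loss, with \<open>a\<close> in the role of the negated
  slope; each branch of the loss is treated separately.\<close>

lemma loss_dual_le:
  assumes "0 \<le> \<gamma>" "0 \<le> a" "a \<le> 1"
  shows "a * (1 - x) - \<gamma> / 2 * a\<^sup>2 \<le> loss \<gamma> x"
proof -
  have "0 \<le> \<gamma> / 2 * a\<^sup>2" using assms by simp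
  moreover have "a * (1 - x) \<le> max 0 (1 - x)"
  proof (cases "x \<le> 1")
    case True
    then show ?thesis using assms mult_right_mono [of a 1 "1 - x"] by simp
  next
    case False
    then show ?thesis using assms by (simp add: mult_nonneg_nonpos max_def)
  qed
  ultimately have "a * (1 - x) - \<gamma> / 2 * a\<^sup>2 \<le> max 0 (1 - x)" by linarith
  moreover have "a * (1 - x) - \<gamma> / 2 * a\<^sup>2 \<le> 1 / (2 * \<gamma>) * (1 - x)\<^sup>2" if "\<gamma> > 0"
  proof -
    \<comment> \<open>Completing the square: this is exactly the gap on the quadratic
      branch.\<close>
    have "0 \<le> (1 - x - \<gamma> * a)\<^sup>2 / (2 * \<gamma>)"
      using that by simp
    also have "\<dots> = 1 / (2 * \<gamma>) * (1 - x)\<^sup>2 - (a * (1 - x) - \<gamma> / 2 * a\<^sup>2)"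
      using that by (simp add: field_simps power2_eq_square)
    finally show ?thesis by simp
  qed
  moreover have "a * (1 - x) - \<gamma> / 2 * a\<^sup>2 \<le> 1 - x - \<gamma> / 2" if "x < 1 - \<gamma>"
  proof -
    \<comment> \<open>The gap on the linear branch, in factored form.\<close>
    have "0 \<le> (1 - a) * ((1 - x) - \<gamma> / 2 * (1 + a))"
    proof (intro mult_nonneg_nonneg)
      have "\<gamma> * (1 + a) \<le> \<gamma> * 2" using assms by (intro mult_left_mono) auto
      then show "0 \<le> (1 - x) - \<gamma> / 2 * (1 + a)" using that by simp
    qed (use assms in simp)
    then show ?thesis
      by (simp add: algebra_simps power2_eq_square add_divide_distrib diff_divide_distrib)
  qed
  ultimately show ?thesis
    using assms(1) unfolding loss_def by (auto simp: max_def split: if_splits)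
qed

text \<open>The maximiser is the negated slope of the loss: 0 beyond 1,
  \<open>(1 - x) / \<gamma>\<close> on the quadratic branch, 1 otherwise.\<close>

lemma loss_dual_attained:
  assumes "0 \<le> \<gamma>"
  obtains a where "0 \<le> a" "a \<le> 1" "loss \<gamma> x = a * (1 - x) - \<gamma> / 2 * a\<^sup>2"
proof (cases "x > 1")
  case True
  then show thesis using that [of 0] by (simp add: loss_def)
next
  case x: False
  show thesis
  proof (cases "\<gamma> > 0 \<and> 1 - \<gamma> \<le> x")
    case True
    then show thesis
      using that [of "(1 - x) / \<gamma>"] x by (simp add: loss_def field_simps power2_eq_square)
  next
    case False
    then show thesis using that [of 1] x assms by (auto simp: loss_def)
  qed
qed

text \<open>The loss is the supremum over \<open>a \<in> [0, 1]\<close> of the affine functions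
  \<open>x \<mapsto> a (1 - x) - \<gamma> a\<^sup>2 / 2\<close>.\<close>

lemma convex_loss:
  assumes "0 \<le> \<gamma>"
  shows "convex_on UNIV (loss \<gamma>)"
  unfolding convex_on_def
proof (intro conjI ballI allI impI convex_UNIV)
  fix x y u v :: real
  assume uv: "0 \<le> u" "0 \<le> v" "u + v = 1"
  obtain a where a: "0 \<le> a" "a \<le> 1"
    "loss \<gamma> (u *\<^sub>R x + v *\<^sub>R y) = a * (1 - (u *\<^sub>R x + v *\<^sub>R y)) - \<gamma> / 2 * a\<^sup>2"
    using loss_dual_attained [OF assms] .
  have v: "v = 1 - u" using uv by simp
  have "loss \<gamma> (u *\<^sub>R x + v *\<^sub>R y) = u * (a * (1 - x) - \<gamma> / 2 * a\<^sup>2) + v * (a * (1 - y) - \<gamma> / 2 * a\<^sup>2)"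
    by (simp only: a(3)) (simp add: v algebra_simps add_divide_distrib diff_divide_distrib)
  also have "\<dots> \<le> u * loss \<gamma> x + v * loss \<gamma> y"
    using uv a assms by (intro add_mono mult_left_mono loss_dual_le) auto
  finally show "loss \<gamma> (u *\<^sub>R x + v *\<^sub>R y) \<le> u * loss \<gamma> x + v * loss \<gamma> y" .
qed

text \<open>The convexity gap is \<open>t * (1 - t)\<close> times the squared distance of the two
  points.\<close>

lemma convex_on_norm_power2: "convex_on UNIV (\<lambda>x::'a::real_inner. (norm x)\<^sup>2)"
proof (rule convex_onI)
  fix t :: real and x y :: 'a
  assume t: "0 < t" "t < 1"
  have "0 \<le> t * (1 - t) * ((x - y) \<bullet> (x - y))"
    using t by simp
  then show "(norm ((1 - t) *\<^sub>R x + t *\<^sub>R y))\<^sup>2 \<le> (1 - t) * (norm x)\<^sup>2 + t * (norm y)\<^sup>2"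
    by (simp add: power2_norm_eq_inner inner_add_left inner_add_right inner_diff_left
        inner_diff_right inner_commute algebra_simps)
qed simp

section \<open>Triplets and the comparison of the two bounds\<close>

lemma finite_triplets: "finite (triplets n y)"
  by (rule finite_subset [of _ "{1..n} \<times> {1..n} \<times> {1..n}"]) (auto simp: triplets_def)

lemma transpose_H_mat: "transpose (H_mat x t) = H_mat x t"
  by (cases t) (simp add: H_mat_def transpose_minus)

theorem theorem3p8:
  fixes n :: nat
    and x :: "nat \<Rightarrow> real^'d"
    and y :: "nat \<Rightarrow> 'c"
    and \<gamma> lam0 lam1 :: real
    and M0 :: "real^'d^'d"
  assumes "\<gamma> \<ge> 0" and "lam0 > 0" and "lam1 > 0"
    and "is_arg_min (primal n x y \<gamma> lam0) psd M0"
  shows "\<exists>G. is_subgradient n x y \<gamma> lam1 M0 G \<and>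
             pgb_center lam1 M0 G = rpb_center lam0 lam1 M0 \<and>
             pgb_sq_radius lam1 M0 G = rpb_sq_radius lam0 lam1 M0"
proof -
  let ?T = "triplets n y" and ?H = "H_mat x"
  have M0: "psd M0"
    and min: "\<And>M. psd M \<Longrightarrow> primal n x y \<gamma> lam0 M0 \<le> primal n x y \<gamma> lam0 M"
    using assms(4) by (auto simp: is_arg_min_linorder)
  have "convex_on {M :: real^'d^'d. psd M} (\<lambda>M. lam0 / 2 * (norm M)\<^sup>2)"
    using assms(2) convex_on_subset [OF convex_on_norm_power2] convex_psd
    by (intro convex_on_cmul) auto
  then obtain g where g: "\<forall>t\<in>?T. g t \<in> subdifferential (loss \<gamma>) (M0 \<bullet> ?H t)"
    and gmin: "\<forall>M\<in>{M. psd M}. (\<Sum>t\<in>?T. g t * (M0 \<bullet> ?H t)) + lam0 / 2 * (norm M0)\<^sup>2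
        \<le> (\<Sum>t\<in>?T. g t * (M \<bullet> ?H t)) + lam0 / 2 * (norm M)\<^sup>2"
    using convex_sum_minimizer_linearize [OF finite_triplets _ convex_loss [OF assms(1)], of n y
        "\<lambda>t M. M \<bullet> ?H t" "{M. psd M}" "\<lambda>M. lam0 / 2 * (norm M)\<^sup>2" M0] M0 min
    by (auto simp: primal_def frob_inner_eq_inner frob_norm_eq_norm bounded_linear.linear
        bounded_linear_inner_left)
  define L where "L = (\<Sum>t\<in>?T. g t *\<^sub>R ?H t)"
  define S where "S = L + lam0 *\<^sub>R M0"
  have "L \<bullet> M = (\<Sum>t\<in>?T. g t * (M \<bullet> ?H t))" for M
    by (simp add: L_def inner_sum_left inner_commute [of M])
  with gmin have var: "0 \<le> S \<bullet> (M - M0)" if "psd M" for M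
    using that M0 convex_psd unfolding S_def
    by (intro regularized_minimizer_variational [of "{M. psd M}"]) auto
  \<comment> \<open>The cone contains 0 and \<open>M0 + M0\<close>, and these two directions bound
    the inner product from above and below.\<close>
  have SM0: "S \<bullet> M0 = 0"
    using var [OF psd_zero] var [OF psd_add [OF M0 M0]] by (simp add: inner_diff_right)
  have "transpose S = S"
    using M0 by (simp add: S_def L_def psd_def transpose_add transpose_sum transpose_scaleR transpose_H_mat)
  then have S: "psd S"
    using var SM0 by (intro dual_psd_cone) (auto simp: inner_diff_right)
  have "M0 ** S = 0"
    using psd_inner_zero_imp_mult_zero [OF M0 S] SM0 by (simp add: inner_commute)

  \<comment> \<open>The loss slopes \<open>g\<close> do not involve the regularisation parameter, so
    they also give a subgradient for \<open>lam1\<close>.\<close>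
  define G where "G = L + lam1 *\<^sub>R M0"
  define A where "A = ((lam0 + lam1) / (2 * lam1)) *\<^sub>R M0"
  define B where "B = (1 / (2 * lam1)) *\<^sub>R S"
  have G: "G = S + (lam1 - lam0) *\<^sub>R M0"
    by (simp add: G_def S_def algebra_simps)
  have "(lam0 + lam1) / (2 * lam1) = 1 - (lam1 - lam0) / (2 * lam1)"
    using assms(3) by (simp add: field_simps)
  then have "A = M0 - ((lam1 - lam0) / (2 * lam1)) *\<^sub>R M0"
    by (simp only: A_def scaleR_diff_left scaleR_one)
  then have Q: "M0 - (1 / (2 * lam1)) *\<^sub>R G = A - B"
    by (simp add: G B_def scaleR_add_right del: scaleR_diff_left)
  have "psd A" "psd B"
    using M0 S assms(2,3) by (auto simp: A_def B_def intro!: psd_scaleR)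
  moreover have "A ** B = 0"
    using \<open>M0 ** S = 0\<close> by (simp add: A_def B_def matrix_scalar_ac flip: scalar_matrix_assoc)
  ultimately have parts: "pos_part (A - B) = A" "neg_part (A - B) = - B"
    by (rule pos_neg_part_diff)+
  \<comment> \<open>Pythagoras, since \<open>S\<close> is orthogonal to \<open>M0\<close>. After
    scaling, the \<open>S\<close> term cancels against the squared norm of the negative part
    \<open>- B\<close>.\<close>
  have "(norm G)\<^sup>2 = (norm S)\<^sup>2 + (lam1 - lam0)\<^sup>2 * (norm M0)\<^sup>2"
    unfolding power2_norm_eq_inner using SM0
    by (simp add: G inner_add_left inner_add_right inner_commute [of M0 S] power2_eq_square)
  then have "pgb_sq_radius lam1 M0 G = rpb_sq_radius lam0 lam1 M0"
    unfolding pgb_sq_radius_def Q parts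
    by (simp add: rpb_sq_radius_def B_def frob_norm_eq_norm power_mult_distrib power_divide
        power2_commute [of lam0] add_divide_distrib)
  moreover have "is_subgradient n x y \<gamma> lam1 M0 G"
    using g by (auto simp: is_subgradient_def G_def L_def frob_inner_eq_inner)
  moreover have "pgb_center lam1 M0 G = rpb_center lam0 lam1 M0"
    unfolding pgb_center_def Q parts by (simp add: rpb_center_def A_def)
  ultimately show ?thesis by blast
qed

end
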